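(* Let $\alpha>0$, let $X$ be a complex Banach space and let $A\in\mathcal{B}(X)$ with $\|A\|<1$. Then $A$ generates a discrete $\alpha$-resolvent family $\{\mathcal{S}_\alpha(n)\}_{n\in\mathbb{N}_0}$ given by $$\mathcal{S}_\alpha(n)=\sum_{j=0}^{\infty}k^{\alpha(j+1)}(n)A^j,\qquad n\in\mathbb{N}_0.$$
   Context: $\mathbb{N}_0=\{0,1,2,\dots\}$; $\mathcal{B}(X)$ is the space of bounded linear operators on $X$. For $\beta>0$ and $n\in\mathbb{N}_0$, $k^{\beta}(n):=\frac{\Gamma(\beta+n)}{\Gamma(\beta)\Gamma(n+1)}$. For sequences, $(a*v)(n):=\sum_{j=0}^n a(n-j)v(j)$. Let $\alpha>0$ and let $A$ be a closed linear operator with domain $D(A)\subset X$. A sequence $\{\mathcal{S}_\alpha(n)\}_{n\in\mathbb{N}_0}\subset\mathcal{B}(X)$ is called a discrete $\alpha$-resolvent family generated by $A$ if: (i) $\mathcal{S}_\alpha(n)x\in D(A)$ and $\mathcal{S}_\alpha(n)Ax=A\mathcal{S}_\alpha(n)x$ for all $n\in\mathbb{N}_0$, $x\in D(A)$; (ii) $(k^\alpha*\mathcal{S}_\alpha)(n)x\in D(A)$ and $\mathcal{S}_\alpha(n)x=k^\alpha(n)x+A(k^\alpha*\mathcal{S}_\alpha)(n)x$ for all $n\in\mathbb{N}_0$, $x\in X$. *)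

theory Defs
  imports "HOL-Analysis.Analysis"
begin

text \<open>Complex normed and Banach spaces. The real structure is the restriction of the complex one,
  so that the norm, the topology and completeness are those of the library classes.\<close>

class complex_normed_vector = real_normed_vector +
  fixes scaleC :: "complex \<Rightarrow> 'a \<Rightarrow> 'a"  (infixr "*\<^sub>C" 75)
  assumes scaleC_add_right: "c *\<^sub>C (x + y) = c *\<^sub>C x + c *\<^sub>C y"
    and scaleC_add_left: "(c + d) *\<^sub>C x = c *\<^sub>C x + d *\<^sub>C x"
    and scaleC_scaleC: "c *\<^sub>C d *\<^sub>C x = (c * d) *\<^sub>C x"
    and scaleC_of_real: "complex_of_real r *\<^sub>C x = r *\<^sub>R x"
    and norm_scaleC: "norm (c *\<^sub>C x) = cmod c * norm x"

class complex_banach = complex_normed_vector + banach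

instantiation complex :: complex_banach
begin

definition scaleC_complex :: "complex \<Rightarrow> complex \<Rightarrow> complex" where
  "scaleC_complex c x = c * x"

instance
  by standard (simp_all add: scaleC_complex_def algebra_simps norm_mult scaleR_conv_of_real)

end

text \<open>The space \<open>\<B>(X)\<close>, as the complex-linear members of the library type of bounded
  real-linear operators. The operator norm does not depend on the scalar field.\<close>

definition bounded_ops :: "('a::complex_normed_vector \<Rightarrow>\<^sub>L 'a) set" where
  "bounded_ops = {T. \<forall>c x. blinfun_apply T (c *\<^sub>C x) = c *\<^sub>C blinfun_apply T x}"

definition op_power :: "('a::real_normed_vector \<Rightarrow>\<^sub>L 'a) \<Rightarrow> nat \<Rightarrow> ('a \<Rightarrow>\<^sub>L 'a)" where
  "op_power T n = ((\<lambda>U. T o\<^sub>L U) ^^ n) id_blinfun"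

text \<open>An unbounded operator is a subspace \<open>D\<close> together with a function whose values outside \<open>D\<close>
  are irrelevant.\<close>

definition closed_operator :: "'a::complex_normed_vector set \<Rightarrow> ('a \<Rightarrow> 'a) \<Rightarrow> bool" where
  "closed_operator D A \<longleftrightarrow>
     0 \<in> D \<and> (\<forall>x\<in>D. \<forall>y\<in>D. x + y \<in> D) \<and> (\<forall>c. \<forall>x\<in>D. c *\<^sub>C x \<in> D) \<and>
     (\<forall>x\<in>D. \<forall>y\<in>D. A (x + y) = A x + A y) \<and> (\<forall>c. \<forall>x\<in>D. A (c *\<^sub>C x) = c *\<^sub>C A x) \<and>
     closed {(x, A x) | x. x \<in> D}"

definition kern :: "real \<Rightarrow> nat \<Rightarrow> real" where
  "kern \<beta> n = Gamma (\<beta> + real n) / (Gamma \<beta> * Gamma (real n + 1))"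

definition conv :: "(nat \<Rightarrow> real) \<Rightarrow> (nat \<Rightarrow> 'b::real_vector) \<Rightarrow> nat \<Rightarrow> 'b" where
  "conv a v n = (\<Sum>j=0..n. a (n - j) *\<^sub>R v j)"

definition discrete_resolvent_family ::
  "real \<Rightarrow> 'a::complex_banach set \<Rightarrow> ('a \<Rightarrow> 'a) \<Rightarrow> (nat \<Rightarrow> ('a \<Rightarrow>\<^sub>L 'a)) \<Rightarrow> bool" where
  "discrete_resolvent_family \<alpha> D A S \<longleftrightarrow>
     \<alpha> > 0 \<and> closed_operator D A \<and> (\<forall>n. S n \<in> bounded_ops) \<and>
     (\<forall>n. \<forall>x\<in>D. blinfun_apply (S n) x \<in> D \<and>
        blinfun_apply (S n) (A x) = A (blinfun_apply (S n) x)) \<and>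
     (\<forall>n x. blinfun_apply (conv (kern \<alpha>) S n) x \<in> D \<and>
        blinfun_apply (S n) x = kern \<alpha> n *\<^sub>R x + A (blinfun_apply (conv (kern \<alpha>) S n) x))"

end

theory Submission
  imports Defs "HOL-Real_Asymp.Real_Asymp"
begin

text \<open>The family is the series obtained by solving the resolvent equation
  \<open>S = k\<^sup>\<alpha> + A (k\<^sup>\<alpha> * S)\<close> by iteration. Because the kernels form a convolution semigroup,
  \<open>k\<^sup>\<alpha> * k\<^sup>\<beta> = k\<^sup>\<alpha>\<^sup>+\<^sup>\<beta>\<close> (\<open>conv_kern_kern\<close>; this is Vandermonde's identity for rising factorials),
  convolving the series with \<open>k\<^sup>\<alpha>\<close> replaces the coefficient of \<open>A\<^sup>j\<close> by that of \<open>A\<^sup>j\<^sup>+\<^sup>1\<close>.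
  Composing with \<open>A\<close> then gives the series without its first term, and that term is
  \<open>k\<^sup>\<alpha>(n)\<close> times the identity.

  The series converges because for fixed \<open>n\<close> the coefficient \<open>k\<^sup>\<beta>(n)\<close> is a polynomial in \<open>\<beta>\<close>, so
  the terms are dominated by a polynomial in \<open>j\<close> times \<open>\<parallel>A\<parallel>\<^sup>j\<close>
  (\<open>summable_kern_op_power\<close>). Commutation with \<open>A\<close> and complex linearity hold for
  each power of \<open>A\<close> and pass to the limit.\<close>

section \<open>The kernels\<close>

lemma kern_eq_pochhammer:
  assumes "\<beta> > 0"
  shows "kern \<beta> n = pochhammer \<beta> n / fact n"
proof -
  have "\<beta> \<notin> \<int>\<^sub>\<le>\<^sub>0"
    using assms by (auto elim!: nonpos_Ints_cases)
  then have "pochhammer \<beta> n = Gamma (\<beta> + real n) / Gamma \<beta>"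
    by (rule pochhammer_Gamma)
  moreover have "Gamma (real n + 1) = fact n"
    using Gamma_fact[of n, where 'a = real] by (simp add: add.commute)
  ultimately show ?thesis
    by (simp add: kern_def)
qed

text \<open>After division by \<open>n!\<close>, the binomial coefficients in Vandermonde's identity for rising
  factorials are absorbed into the two kernels.\<close>

lemma conv_kern_kern:
  assumes "\<alpha> > 0" "\<beta> > 0"
  shows "conv (kern \<alpha>) (kern \<beta>) n = kern (\<alpha> + \<beta>) n"
proof -
  have "kern (\<beta> + \<alpha>) n = (\<Sum>k\<le>n. of_nat (n choose k) * pochhammer \<beta> k * pochhammer \<alpha> (n - k)) / fact n"
    using assms by (simp add: kern_eq_pochhammer pochhammer_binomial_sum)
  also have "\<dots> = (\<Sum>k\<le>n. kern \<alpha> (n - k) * kern \<beta> k)"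
    unfolding sum_divide_distrib
    using assms by (intro sum.cong) (auto simp: kern_eq_pochhammer binomial_fact mult.commute)
  finally show ?thesis
    by (simp add: conv_def atLeast0AtMost add.commute)
qed

lemma kern_nonneg: "\<beta> > 0 \<Longrightarrow> kern \<beta> n \<ge> 0"
  by (simp add: kern_eq_pochhammer pochhammer_nonneg)

text \<open>Each of the \<open>n\<close> factors of the rising factorial is at most \<open>\<beta> + n\<close>. What matters is that
  the bound is polynomial in \<open>\<beta>\<close>.\<close>

lemma kern_le:
  assumes "\<beta> > 0"
  shows "kern \<beta> n \<le> (\<beta> + real n) ^ n"
proof -
  have "pochhammer \<beta> n = (\<Prod>i<n. \<beta> + real i)"
    by (simp add: pochhammer_prod atLeast0LessThan)
  also have "\<dots> \<le> (\<Prod>i<n. \<beta> + real n)"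
    using assms by (intro prod_mono) auto
  finally have "pochhammer \<beta> n \<le> (\<beta> + real n) ^ n"
    by simp
  moreover have "pochhammer \<beta> n / fact n \<le> pochhammer \<beta> n"
    using divide_left_mono[OF fact_ge_1[of n], of "pochhammer \<beta> n"] assms
    by (simp add: pochhammer_nonneg)
  ultimately show ?thesis
    using assms by (simp add: kern_eq_pochhammer)
qed

lemma summable_kern_power:
  fixes r :: real
  assumes "\<alpha> > 0" "0 \<le> r" "r < 1"
  shows "summable (\<lambda>j. kern (\<alpha> * (real j + 1)) n * r ^ j)"
proof -
  \<comment> \<open>A positive ratio, also for \<open>r = 0\<close>: the asymptotic comparison needs \<open>q ^ j = exp (j ln q)\<close>.\<close>
  define q where "q = (r + 1) / 2"
  have q: "0 < q" "q < 1" "r \<le> q"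
    using assms by (auto simp: q_def)
  have "(\<lambda>j. (\<alpha> * (real j + 1) + real n) ^ n * q ^ j) \<in> O(\<lambda>j. 1 / real j ^ 2)"
    using q assms(1) by real_asymp
  then have "summable (\<lambda>j. (\<alpha> * (real j + 1) + real n) ^ n * q ^ j)"
    by (rule summable_comparison_test_bigo[rotated])
      (use inverse_power_summable[of 2, where 'a = real] in \<open>simp add: field_simps\<close>)
  then show ?thesis
  proof (rule summable_comparison_test'[where N = 0])
    fix j :: nat
    have "\<alpha> * (real j + 1) > 0"
      using assms(1) by simp
    then show "norm (kern (\<alpha> * (real j + 1)) n * r ^ j) \<le> (\<alpha> * (real j + 1) + real n) ^ n * q ^ j"
      using kern_le kern_nonneg assms(2) q(3)
      by (auto simp: abs_mult intro!: mult_mono power_mono)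
  qed
qed

section \<open>Powers of an operator\<close>

lemma op_power_0 [simp]: "op_power T 0 = id_blinfun"
  and op_power_Suc: "op_power T (Suc j) = T o\<^sub>L op_power T j"
  by (simp_all add: op_power_def)

lemma op_power_commute: "blinfun_apply (op_power T j) (blinfun_apply T x) = blinfun_apply T (blinfun_apply (op_power T j) x)"
  by (induction j) (simp_all add: op_power_Suc)

lemma norm_op_power_le: "norm (op_power T j) \<le> norm T ^ j"
proof (induction j)
  case 0
  show ?case
    by (simp add: norm_blinfun_id_le)
next
  case (Suc j)
  have "norm (op_power T (Suc j)) \<le> norm T * norm (op_power T j)"
    by (simp add: op_power_Suc norm_blinfun_compose)
  also have "\<dots> \<le> norm T * norm T ^ j"
    by (intro mult_left_mono Suc) simp
  finally show ?case
    by simp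
qed

lemma op_power_bounded_ops: "T \<in> bounded_ops \<Longrightarrow> op_power T j \<in> bounded_ops"
  by (induction j) (auto simp: bounded_ops_def op_power_Suc)

lemma summable_kern_op_power:
  fixes A :: "'a::banach \<Rightarrow>\<^sub>L 'a"
  assumes "\<alpha> > 0" "norm A < 1"
  shows "summable (\<lambda>j. kern (\<alpha> * (real j + 1)) n *\<^sub>R op_power A j)"
proof (rule summable_comparison_test'[where N = 0])
  show "summable (\<lambda>j. kern (\<alpha> * (real j + 1)) n * norm A ^ j)"
    using assms by (intro summable_kern_power) auto
  show "norm (kern (\<alpha> * (real j + 1)) n *\<^sub>R op_power A j) \<le> kern (\<alpha> * (real j + 1)) n * norm A ^ j" for j
    using assms(1) norm_op_power_le[of A j] by (simp add: kern_nonneg mult_left_mono)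
qed

section \<open>Series of operators\<close>

lemma blinfun_apply_suminf:
  "summable f \<Longrightarrow> blinfun_apply (suminf f) x = (\<Sum>j. blinfun_apply (f j) x)"
  by (rule bounded_linear.suminf[OF blinfun.bounded_linear_left])

lemma blinfun_apply_summable:
  "summable f \<Longrightarrow> summable (\<lambda>j. blinfun_apply (f j) x)"
  by (rule bounded_linear.summable[OF blinfun.bounded_linear_left])

lemma blinfun_compose_suminf:
  "summable f \<Longrightarrow> T o\<^sub>L suminf f = (\<Sum>j. T o\<^sub>L f j)"
  by (rule bounded_linear.suminf[OF bounded_bilinear.bounded_linear_right[OF bounded_bilinear_blinfun_compose]])

lemma bounded_linear_scaleC: "bounded_linear (\<lambda>x::'a::complex_normed_vector. c *\<^sub>C x)"
proof (rule bounded_linear_intro[where K = "cmod c"])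
  fix r and x :: 'a
  show "c *\<^sub>C r *\<^sub>R x = r *\<^sub>R c *\<^sub>C x"
    by (simp add: scaleC_of_real[symmetric] scaleC_scaleC mult.commute)
qed (simp_all add: scaleC_add_right norm_scaleC mult.commute)

lemma scaleR_bounded_ops: "T \<in> bounded_ops \<Longrightarrow> r *\<^sub>R T \<in> bounded_ops"
  by (simp add: bounded_ops_def blinfun.scaleR_left linear_simps(5)[OF bounded_linear_scaleC])

lemma suminf_bounded_ops:
  assumes "summable f" "\<And>j. f j \<in> bounded_ops"
  shows "suminf f \<in> bounded_ops"
  using assms
  by (simp add: bounded_ops_def blinfun_apply_suminf blinfun_apply_summable
      bounded_linear.suminf[OF bounded_linear_scaleC])

lemma closed_operator_blinfun:
  assumes "A \<in> bounded_ops"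
  shows "closed_operator UNIV (blinfun_apply A)"
proof -
  have "closed ((\<lambda>x. (x, blinfun_apply A x)) ` UNIV)"
    by (intro continuous_closed_graph closed_UNIV continuous_intros)
  then show ?thesis
    using assms by (simp add: closed_operator_def bounded_ops_def blinfun.add_right full_SetCompr_eq)
qed

section \<open>The resolvent equation\<close>

text \<open>Exchanging the finite convolution with the series convolves the coefficients term by term,
  which raises the exponent of each kernel by \<open>\<alpha>\<close>. Composing with \<open>A\<close> raises the power of \<open>A\<close>
  by one, so the two shifts together produce the series without its first term.\<close>

lemma kern_series_resolvent_equation:
  fixes A :: "'a::banach \<Rightarrow>\<^sub>L 'a"
  assumes "\<alpha> > 0" "norm A < 1"
  defines "S \<equiv> (\<lambda>n. \<Sum>j. kern (\<alpha> * (real j + 1)) n *\<^sub>R op_power A j)"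
  shows "S n = kern \<alpha> n *\<^sub>R id_blinfun + (A o\<^sub>L conv (kern \<alpha>) S n)"
proof -
  note summ = summable_kern_op_power[OF assms(1,2)]
  have conv_coeff: "conv (kern \<alpha>) (kern (\<alpha> * (real j + 1))) n = kern (\<alpha> * (real (Suc j) + 1)) n" for j
  proof -
    have "\<alpha> * (real j + 1) > 0"
      using assms(1) by simp
    from conv_kern_kern[OF assms(1) this] show ?thesis
      by (simp add: algebra_simps)
  qed
  have "conv (kern \<alpha>) S n
      = (\<Sum>i=0..n. \<Sum>j. kern \<alpha> (n - i) *\<^sub>R kern (\<alpha> * (real j + 1)) i *\<^sub>R op_power A j)"
    by (simp add: conv_def S_def suminf_scaleR_right[OF summ])
  also have "\<dots> = (\<Sum>j. \<Sum>i=0..n. kern \<alpha> (n - i) *\<^sub>R kern (\<alpha> * (real j + 1)) i *\<^sub>R op_power A j)"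
    by (intro suminf_sum[symmetric] summable_scaleR_right summ)
  also have "\<dots> = (\<Sum>j. kern (\<alpha> * (real (Suc j) + 1)) n *\<^sub>R op_power A j)"
    unfolding conv_coeff[symmetric] by (simp add: conv_def scaleR_sum_left)
  finally have conv_eq: "conv (kern \<alpha>) S n = (\<Sum>j. kern (\<alpha> * (real (Suc j) + 1)) n *\<^sub>R op_power A j)" .
  have "summable (\<lambda>j. \<Sum>i=0..n. kern \<alpha> (n - i) *\<^sub>R kern (\<alpha> * (real j + 1)) i *\<^sub>R op_power A j)"
    by (intro summable_sum summable_scaleR_right summ)
  then have summ': "summable (\<lambda>j. kern (\<alpha> * (real (Suc j) + 1)) n *\<^sub>R op_power A j)"
    unfolding conv_coeff[symmetric] by (simp add: conv_def scaleR_sum_left)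
  have "A o\<^sub>L conv (kern \<alpha>) S n = (\<Sum>j. kern (\<alpha> * (real (Suc j) + 1)) n *\<^sub>R op_power A (Suc j))"
    unfolding conv_eq blinfun_compose_suminf[OF summ']
    by (simp add: op_power_Suc bounded_bilinear.scaleR_right[OF bounded_bilinear_blinfun_compose])
  then show ?thesis
    using suminf_split_head[OF summ[of n]] by (simp add: S_def)
qed

theorem proposition3p2:
  fixes A :: "'a::complex_banach \<Rightarrow>\<^sub>L 'a" and \<alpha> :: real
  assumes "\<alpha> > 0" and "A \<in> bounded_ops" and "norm A < 1"
  shows "(\<forall>n. summable (\<lambda>j. kern (\<alpha> * (real j + 1)) n *\<^sub>R op_power A j)) \<and>
    discrete_resolvent_family \<alpha> UNIV (blinfun_apply A)
      (\<lambda>n. \<Sum>j. kern (\<alpha> * (real j + 1)) n *\<^sub>R op_power A j)"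
proof -
  define S where "S = (\<lambda>n. \<Sum>j. kern (\<alpha> * (real j + 1)) n *\<^sub>R op_power A j)"
  note summ = summable_kern_op_power[OF assms(1,3)]
  have ops: "S n \<in> bounded_ops" for n
    unfolding S_def by (intro suminf_bounded_ops summ scaleR_bounded_ops op_power_bounded_ops assms)
  have commute: "blinfun_apply (S n) (blinfun_apply A x) = blinfun_apply A (blinfun_apply (S n) x)" for n x
  proof -
    let ?f = "\<lambda>j. kern (\<alpha> * (real j + 1)) n *\<^sub>R op_power A j"
    have "blinfun_apply (S n) (blinfun_apply A x) = (\<Sum>j. blinfun_apply A (blinfun_apply (?f j) x))"
      unfolding S_def blinfun_apply_suminf[OF summ]
      by (simp add: blinfun.scaleR_left blinfun.scaleR_right op_power_commute)
    also have "\<dots> = blinfun_apply A (\<Sum>j. blinfun_apply (?f j) x)"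
      by (rule bounded_linear.suminf[OF blinfun.bounded_linear_right, symmetric])
        (rule blinfun_apply_summable[OF summ])
    finally show ?thesis
      by (simp add: S_def blinfun_apply_suminf[OF summ])
  qed
  have "blinfun_apply (S n) x = kern \<alpha> n *\<^sub>R x + blinfun_apply A (blinfun_apply (conv (kern \<alpha>) S n) x)" for n x
    using arg_cong[OF kern_series_resolvent_equation[OF assms(1,3), of n], of "\<lambda>T. blinfun_apply T x"]
    by (simp add: S_def blinfun.add_left blinfun.scaleR_left)
  then have "discrete_resolvent_family \<alpha> UNIV (blinfun_apply A) S"
    using assms(1) ops commute closed_operator_blinfun[OF assms(2)]
    by (simp add: discrete_resolvent_family_def)
  then show ?thesis
    using summ by (simp add: S_def)
qed

end
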